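(* Let $\mathscr{M}$ be an arbitrary monoidal category, and let $M$ be an object of $\mathscr{M}$. Then there is a unique strict monoidal functor $\mathscr{W}\to\mathscr{M}$ such that $W\mapsto M$.
   Context: This is Mac Lane's coherence theorem. $\mathscr{W}$ denotes Mac Lane's preorder on one generating object $W$, regarded as a (non-strict) monoidal category. Its objects are the formal expressions built from a unit symbol $I$ and the symbol $W$ by a binary operation $\otimes$. The size (Mac Lane: length) of an object is its number of occurrences of $W$. There is exactly one morphism $A\to B$ when $A$ and $B$ have the same size, and none otherwise; so $\mathscr{W}$ is a preorder, meaning a category with at most one morphism from any object to any other. The monoidal product on objects is the formal operation $\otimes$, the unit is $I$, and the product of morphisms, the associators $\alpha$ and the unitors $\lambda,\rho$ are the unique morphisms of the required types. The monoidal category $\mathscr{M}$ is not assumed strict. A strict monoidal functor is a monoidal functor whose coherence maps are identities; thus it preserves $\otimes$, the unit, the associators and the unitors on the nose. *)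

theory Defs
  imports Main "HOL-Library.FuncSet"
begin

text \<open>
  A small category has a carrier set of objects and one carrier set of arrows. All operations
  are total HOL functions whose values matter only on the carriers (and, for composition, on
  composable pairs). \<open>Comp C g f\<close> is the composite \<open>g \<circ> f\<close>.
\<close>

record ('o, 'm) cat =
  Ob :: "'o set"
  Ar :: "'m set"
  Dom :: "'m \<Rightarrow> 'o"
  Cod :: "'m \<Rightarrow> 'o"
  Ide :: "'o \<Rightarrow> 'm" ("\<one>\<index>")
  Comp :: "'m \<Rightarrow> 'm \<Rightarrow> 'm" (infixl "\<cdot>\<index>" 65)

definition hom :: "('o, 'm, 'x) cat_scheme \<Rightarrow> 'o \<Rightarrow> 'o \<Rightarrow> 'm set" where
  "hom C A B = {f \<in> Ar C. Dom C f = A \<and> Cod C f = B}"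

locale category =
  fixes C :: "('o, 'm, 'x) cat_scheme" (structure)
  assumes Dom_Ob: "f \<in> Ar C \<Longrightarrow> Dom C f \<in> Ob C"
    and Cod_Ob: "f \<in> Ar C \<Longrightarrow> Cod C f \<in> Ob C"
    and Ide_hom: "A \<in> Ob C \<Longrightarrow> \<one> A \<in> hom C A A"
    and Comp_hom: "\<lbrakk>f \<in> hom C A B; g \<in> hom C B D\<rbrakk> \<Longrightarrow> g \<cdot> f \<in> hom C A D"
    and Comp_Ide_right: "f \<in> hom C A B \<Longrightarrow> f \<cdot> \<one> A = f"
    and Comp_Ide_left: "f \<in> hom C A B \<Longrightarrow> \<one> B \<cdot> f = f"
    and Comp_assoc: "\<lbrakk>f \<in> hom C A B; g \<in> hom C B D; h \<in> hom C D E\<rbrakk>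
      \<Longrightarrow> h \<cdot> (g \<cdot> f) = (h \<cdot> g) \<cdot> f"

definition is_iso :: "('o, 'm, 'x) cat_scheme \<Rightarrow> 'o \<Rightarrow> 'o \<Rightarrow> 'm \<Rightarrow> bool" where
  "is_iso C A B f \<longleftrightarrow> f \<in> hom C A B \<and>
     (\<exists>g \<in> hom C B A. Comp C g f = Ide C A \<and> Comp C f g = Ide C B)"

record ('o, 'm) moncat = "('o, 'm) cat" +
  TensOb :: "'o \<Rightarrow> 'o \<Rightarrow> 'o" (infixr "\<otimes>\<index>" 70)
  TensAr :: "'m \<Rightarrow> 'm \<Rightarrow> 'm" (infixr "\<odot>\<index>" 70)
  Unit :: 'o ("\<I>\<index>")
  Assoc :: "'o \<Rightarrow> 'o \<Rightarrow> 'o \<Rightarrow> 'm" ("\<alpha>\<index>")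
  Lunit :: "'o \<Rightarrow> 'm" ("\<lambda>\<lambda>\<index>")
  Runit :: "'o \<Rightarrow> 'm" ("\<rho>\<index>")

text \<open>
  Orientation: \<open>\<alpha> A B D : (A \<otimes> B) \<otimes> D \<rightarrow> A \<otimes> (B \<otimes> D)\<close>, \<open>\<lambda>\<lambda> A : \<I> \<otimes> A \<rightarrow> A\<close>,
  \<open>\<rho> A : A \<otimes> \<I> \<rightarrow> A\<close>. The product of arrows is written \<open>\<odot>\<close>.
\<close>

locale monoidal_category = category C
  for C :: "('o, 'm, 'x) moncat_scheme" (structure) +
  assumes TensOb_Ob: "\<lbrakk>A \<in> Ob C; B \<in> Ob C\<rbrakk> \<Longrightarrow> A \<otimes> B \<in> Ob C"
    and TensAr_hom: "\<lbrakk>f \<in> hom C A A'; g \<in> hom C B B'\<rbrakk>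
      \<Longrightarrow> f \<odot> g \<in> hom C (A \<otimes> B) (A' \<otimes> B')"
    and TensAr_Ide: "\<lbrakk>A \<in> Ob C; B \<in> Ob C\<rbrakk> \<Longrightarrow> \<one> A \<odot> \<one> B = \<one> (A \<otimes> B)"
    and TensAr_Comp: "\<lbrakk>f \<in> hom C A A'; f' \<in> hom C A' A''; g \<in> hom C B B'; g' \<in> hom C B' B''\<rbrakk>
      \<Longrightarrow> (f' \<cdot> f) \<odot> (g' \<cdot> g) = (f' \<odot> g') \<cdot> (f \<odot> g)"
    and Unit_Ob: "\<I> \<in> Ob C"
    and Assoc_iso: "\<lbrakk>A \<in> Ob C; B \<in> Ob C; D \<in> Ob C\<rbrakk>
      \<Longrightarrow> is_iso C ((A \<otimes> B) \<otimes> D) (A \<otimes> (B \<otimes> D)) (\<alpha> A B D)"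
    and Assoc_natural: "\<lbrakk>f \<in> hom C A A'; g \<in> hom C B B'; h \<in> hom C D D'\<rbrakk>
      \<Longrightarrow> \<alpha> A' B' D' \<cdot> ((f \<odot> g) \<odot> h) = (f \<odot> (g \<odot> h)) \<cdot> \<alpha> A B D"
    and Lunit_iso: "A \<in> Ob C \<Longrightarrow> is_iso C (\<I> \<otimes> A) A (\<lambda>\<lambda> A)"
    and Lunit_natural: "f \<in> hom C A A' \<Longrightarrow> \<lambda>\<lambda> A' \<cdot> (\<one> \<I> \<odot> f) = f \<cdot> \<lambda>\<lambda> A"
    and Runit_iso: "A \<in> Ob C \<Longrightarrow> is_iso C (A \<otimes> \<I>) A (\<rho> A)"
    and Runit_natural: "f \<in> hom C A A' \<Longrightarrow> \<rho> A' \<cdot> (f \<odot> \<one> \<I>) = f \<cdot> \<rho> A"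
    and pentagon: "\<lbrakk>A \<in> Ob C; B \<in> Ob C; D \<in> Ob C; E \<in> Ob C\<rbrakk>
      \<Longrightarrow> \<alpha> A B (D \<otimes> E) \<cdot> \<alpha> (A \<otimes> B) D E
        = (\<one> A \<odot> \<alpha> B D E) \<cdot> \<alpha> A (B \<otimes> D) E \<cdot> (\<alpha> A B D \<odot> \<one> E)"
    and triangle: "\<lbrakk>A \<in> Ob C; B \<in> Ob C\<rbrakk>
      \<Longrightarrow> (\<one> A \<odot> \<lambda>\<lambda> B) \<cdot> \<alpha> A \<I> B = \<rho> A \<odot> \<one> B"

text \<open>
  The components of a functor are required to be extensional (\<open>undefined\<close> off the carriers),
  so that HOL equality of functors is equality of their actions on objects and arrows.
\<close>

record ('o, 'm, 'p, 'n) cfunctor =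
  ObMap :: "'o \<Rightarrow> 'p"
  ArMap :: "'m \<Rightarrow> 'n"

locale category_functor = C: category C + D: category D
  for C :: "('o, 'm, 'x) cat_scheme"
    and D :: "('p, 'n, 'y) cat_scheme"
    and F :: "('o, 'm, 'p, 'n, 'z) cfunctor_scheme" +
  assumes ObMap_funcset: "ObMap F \<in> Ob C \<rightarrow>\<^sub>E Ob D"
    and ArMap_funcset: "ArMap F \<in> Ar C \<rightarrow>\<^sub>E Ar D"
    and ArMap_hom: "f \<in> hom C A B \<Longrightarrow> ArMap F f \<in> hom D (ObMap F A) (ObMap F B)"
    and ArMap_Ide: "A \<in> Ob C \<Longrightarrow> ArMap F (Ide C A) = Ide D (ObMap F A)"
    and ArMap_Comp: "\<lbrakk>f \<in> hom C A B; g \<in> hom C B E\<rbrakk>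
      \<Longrightarrow> ArMap F (g \<cdot>\<^bsub>C\<^esub> f) = ArMap F g \<cdot>\<^bsub>D\<^esub> ArMap F f"

text \<open>
  The coherence maps \<open>Tensorator F (A, B) : F A \<otimes> F B \<rightarrow> F (A \<otimes> B)\<close> and
  \<open>Unitor F : \<I> \<rightarrow> F \<I>\<close> are part of the data of a monoidal functor. As in Mac Lane they are not
  required to be invertible; for strict monoidal functors this makes no difference.
\<close>

record ('o, 'm, 'p, 'n) moncat_functor = "('o, 'm, 'p, 'n) cfunctor" +
  Tensorator :: "'o \<times> 'o \<Rightarrow> 'n"
  Unitor :: 'n

locale monoidal_functor =
  C: monoidal_category C + D: monoidal_category D + category_functor C D F
  for C :: "('o, 'm, 'x) moncat_scheme"
    and D :: "('p, 'n, 'y) moncat_scheme"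
    and F :: "('o, 'm, 'p, 'n, 'z) moncat_functor_scheme" +
  assumes Tensorator_extensional: "Tensorator F \<in> extensional (Ob C \<times> Ob C)"
    and Tensorator_hom: "\<lbrakk>A \<in> Ob C; B \<in> Ob C\<rbrakk>
      \<Longrightarrow> Tensorator F (A, B) \<in> hom D (ObMap F A \<otimes>\<^bsub>D\<^esub> ObMap F B) (ObMap F (A \<otimes>\<^bsub>C\<^esub> B))"
    and Tensorator_natural: "\<lbrakk>f \<in> hom C A A'; g \<in> hom C B B'\<rbrakk>
      \<Longrightarrow> Tensorator F (A', B') \<cdot>\<^bsub>D\<^esub> (ArMap F f \<odot>\<^bsub>D\<^esub> ArMap F g)
        = ArMap F (f \<odot>\<^bsub>C\<^esub> g) \<cdot>\<^bsub>D\<^esub> Tensorator F (A, B)"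
    and Unitor_hom: "Unitor F \<in> hom D \<I>\<^bsub>D\<^esub> (ObMap F \<I>\<^bsub>C\<^esub>)"
    and Assoc_coherence: "\<lbrakk>A \<in> Ob C; B \<in> Ob C; E \<in> Ob C\<rbrakk>
      \<Longrightarrow> ArMap F (\<alpha>\<^bsub>C\<^esub> A B E) \<cdot>\<^bsub>D\<^esub> Tensorator F (A \<otimes>\<^bsub>C\<^esub> B, E)
            \<cdot>\<^bsub>D\<^esub> (Tensorator F (A, B) \<odot>\<^bsub>D\<^esub> \<one>\<^bsub>D\<^esub> (ObMap F E))
        = Tensorator F (A, B \<otimes>\<^bsub>C\<^esub> E) \<cdot>\<^bsub>D\<^esub> (\<one>\<^bsub>D\<^esub> (ObMap F A) \<odot>\<^bsub>D\<^esub> Tensorator F (B, E))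
            \<cdot>\<^bsub>D\<^esub> \<alpha>\<^bsub>D\<^esub> (ObMap F A) (ObMap F B) (ObMap F E)"
    and Lunit_coherence: "A \<in> Ob C
      \<Longrightarrow> ArMap F (\<lambda>\<lambda>\<^bsub>C\<^esub> A) \<cdot>\<^bsub>D\<^esub> Tensorator F (\<I>\<^bsub>C\<^esub>, A) \<cdot>\<^bsub>D\<^esub> (Unitor F \<odot>\<^bsub>D\<^esub> \<one>\<^bsub>D\<^esub> (ObMap F A))
        = \<lambda>\<lambda>\<^bsub>D\<^esub> (ObMap F A)"
    and Runit_coherence: "A \<in> Ob C
      \<Longrightarrow> ArMap F (\<rho>\<^bsub>C\<^esub> A) \<cdot>\<^bsub>D\<^esub> Tensorator F (A, \<I>\<^bsub>C\<^esub>) \<cdot>\<^bsub>D\<^esub> (\<one>\<^bsub>D\<^esub> (ObMap F A) \<odot>\<^bsub>D\<^esub> Unitor F)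
        = \<rho>\<^bsub>D\<^esub> (ObMap F A)"

text \<open>
  Being an identity forces the domain and codomain of each coherence map to agree; see
  \<open>strict_ObMap_TensOb\<close> and the lemmas after it.
\<close>

locale strict_monoidal_functor = monoidal_functor C D F
  for C :: "('o, 'm, 'x) moncat_scheme"
    and D :: "('p, 'n, 'y) moncat_scheme"
    and F :: "('o, 'm, 'p, 'n, 'z) moncat_functor_scheme" +
  assumes Tensorator_Ide: "\<lbrakk>A \<in> Ob C; B \<in> Ob C\<rbrakk>
      \<Longrightarrow> Tensorator F (A, B) = \<one>\<^bsub>D\<^esub> (ObMap F A \<otimes>\<^bsub>D\<^esub> ObMap F B)"
    and Unitor_Ide: "Unitor F = \<one>\<^bsub>D\<^esub> \<I>\<^bsub>D\<^esub>"

context strict_monoidal_functor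
begin

lemma ObMap_Ob: "A \<in> Ob C \<Longrightarrow> ObMap F A \<in> Ob D"
  using ObMap_funcset by auto

lemma strict_ObMap_TensOb:
  assumes "A \<in> Ob C" "B \<in> Ob C"
  shows "ObMap F (A \<otimes>\<^bsub>C\<^esub> B) = ObMap F A \<otimes>\<^bsub>D\<^esub> ObMap F B"
  using Tensorator_hom[OF assms] Tensorator_Ide[OF assms]
    D.Ide_hom[OF D.TensOb_Ob[OF assms[THEN ObMap_Ob]]]
  by (simp add: hom_def)

lemma strict_ObMap_Unit: "ObMap F \<I>\<^bsub>C\<^esub> = \<I>\<^bsub>D\<^esub>"
  using Unitor_hom Unitor_Ide D.Ide_hom[OF D.Unit_Ob] by (simp add: hom_def)

lemma strict_ArMap_TensAr:
  assumes f: "f \<in> hom C A A'" and g: "g \<in> hom C B B'"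
  shows "ArMap F (f \<odot>\<^bsub>C\<^esub> g) = ArMap F f \<odot>\<^bsub>D\<^esub> ArMap F g"
proof -
  have ob: "A \<in> Ob C" "A' \<in> Ob C" "B \<in> Ob C" "B' \<in> Ob C"
    using f g C.Dom_Ob C.Cod_Ob by (auto simp: hom_def)
  have l: "ArMap F f \<odot>\<^bsub>D\<^esub> ArMap F g
      \<in> hom D (ObMap F A \<otimes>\<^bsub>D\<^esub> ObMap F B) (ObMap F A' \<otimes>\<^bsub>D\<^esub> ObMap F B')"
    using D.TensAr_hom ArMap_hom f g by blast
  have r: "ArMap F (f \<odot>\<^bsub>C\<^esub> g)
      \<in> hom D (ObMap F A \<otimes>\<^bsub>D\<^esub> ObMap F B) (ObMap F A' \<otimes>\<^bsub>D\<^esub> ObMap F B')"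
    using ArMap_hom[OF C.TensAr_hom[OF f g]] ob by (simp add: strict_ObMap_TensOb)
  show ?thesis
    using Tensorator_natural[OF f g] D.Comp_Ide_left[OF l] D.Comp_Ide_right[OF r] ob
    by (simp add: Tensorator_Ide)
qed

lemma strict_ArMap_Assoc:
  assumes ob: "A \<in> Ob C" "B \<in> Ob C" "E \<in> Ob C"
  shows "ArMap F (\<alpha>\<^bsub>C\<^esub> A B E) = \<alpha>\<^bsub>D\<^esub> (ObMap F A) (ObMap F B) (ObMap F E)"
proof -
  let ?s = "(ObMap F A \<otimes>\<^bsub>D\<^esub> ObMap F B) \<otimes>\<^bsub>D\<^esub> ObMap F E"
  let ?t = "ObMap F A \<otimes>\<^bsub>D\<^esub> (ObMap F B \<otimes>\<^bsub>D\<^esub> ObMap F E)"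
  have l: "ArMap F (\<alpha>\<^bsub>C\<^esub> A B E) \<in> hom D ?s ?t"
    using ArMap_hom[of "\<alpha>\<^bsub>C\<^esub> A B E"] C.Assoc_iso[OF ob] ob
    by (force simp: is_iso_def strict_ObMap_TensOb C.TensOb_Ob)
  have r: "\<alpha>\<^bsub>D\<^esub> (ObMap F A) (ObMap F B) (ObMap F E) \<in> hom D ?s ?t"
    using D.Assoc_iso ob ObMap_Ob by (simp add: is_iso_def)
  show ?thesis
    using Assoc_coherence[OF ob] ob D.Comp_Ide_right[OF l] D.Comp_Ide_left[OF r]
    by (simp add: D.Comp_Ide_left[OF D.Ide_hom] Tensorator_Ide C.TensOb_Ob strict_ObMap_TensOb ObMap_Ob
        D.TensAr_Ide D.TensOb_Ob)
qed

lemma strict_ArMap_Lunit: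
  assumes ob: "A \<in> Ob C"
  shows "ArMap F (\<lambda>\<lambda>\<^bsub>C\<^esub> A) = \<lambda>\<lambda>\<^bsub>D\<^esub> (ObMap F A)"
proof -
  have l: "ArMap F (\<lambda>\<lambda>\<^bsub>C\<^esub> A) \<in> hom D (\<I>\<^bsub>D\<^esub> \<otimes>\<^bsub>D\<^esub> ObMap F A) (ObMap F A)"
    using ArMap_hom[of "\<lambda>\<lambda>\<^bsub>C\<^esub> A"] C.Lunit_iso[OF ob] ob
    by (force simp: is_iso_def strict_ObMap_TensOb strict_ObMap_Unit C.Unit_Ob)
  show ?thesis
    using Lunit_coherence[OF ob] ob D.Comp_Ide_right[OF l]
    by (simp add: Tensorator_Ide Unitor_Ide C.Unit_Ob strict_ObMap_Unit ObMap_Ob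
        D.TensAr_Ide D.Unit_Ob)
qed

lemma strict_ArMap_Runit:
  assumes ob: "A \<in> Ob C"
  shows "ArMap F (\<rho>\<^bsub>C\<^esub> A) = \<rho>\<^bsub>D\<^esub> (ObMap F A)"
proof -
  have l: "ArMap F (\<rho>\<^bsub>C\<^esub> A) \<in> hom D (ObMap F A \<otimes>\<^bsub>D\<^esub> \<I>\<^bsub>D\<^esub>) (ObMap F A)"
    using ArMap_hom[of "\<rho>\<^bsub>C\<^esub> A"] C.Runit_iso[OF ob] ob
    by (force simp: is_iso_def strict_ObMap_TensOb strict_ObMap_Unit C.Unit_Ob)
  show ?thesis
    using Runit_coherence[OF ob] ob D.Comp_Ide_right[OF l]
    by (simp add: Tensorator_Ide Unitor_Ide C.Unit_Ob strict_ObMap_Unit ObMap_Ob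
        D.TensAr_Ide D.Unit_Ob)
qed

end

datatype wobj = WUnit | WGen | WTens wobj wobj

fun wlength :: "wobj \<Rightarrow> nat" where
  "wlength WUnit = 0"
| "wlength WGen = 1"
| "wlength (WTens A B) = wlength A + wlength B"

text \<open>
  The unique arrow \<open>A \<rightarrow> B\<close>, for \<open>A\<close> and \<open>B\<close> of the same length, is represented by the
  pair \<open>(A, B)\<close>.
\<close>

definition WCat :: "(wobj, wobj \<times> wobj) moncat" where
  "WCat = \<lparr>
     Ob = UNIV,
     Ar = {(A, B). wlength A = wlength B},
     Dom = fst,
     Cod = snd,
     Ide = (\<lambda>A. (A, A)),
     Comp = (\<lambda>g f. (fst f, snd g)),
     TensOb = WTens,
     TensAr = (\<lambda>f g. (WTens (fst f) (fst g), WTens (snd f) (snd g))),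
     Unit = WUnit,
     Assoc = (\<lambda>A B D. (WTens (WTens A B) D, WTens A (WTens B D))),
     Lunit = (\<lambda>A. (WTens WUnit A, A)),
     Runit = (\<lambda>A. (WTens A WUnit, A))\<rparr>"

lemma hom_WCat: "hom WCat A B = (if wlength A = wlength B then {(A, B)} else {})"
  by (auto simp: hom_def WCat_def)

lemma monoidal_category_WCat: "monoidal_category WCat"
  by unfold_locales
    (auto simp: hom_WCat is_iso_def split: if_splits, auto simp: WCat_def)

end

theory Submission imports Defs begin

text \<open>
  Let \<open>J n = M \<otimes> (M \<otimes> \<dots> \<otimes> \<I>)\<close>. An expression \<open>A\<close> of length \<open>a\<close> acts on these normal forms by
  an explicit isomorphism \<open>absorb A n : A \<otimes> J n \<rightarrow> J (a + n)\<close>, defined by recursion on \<open>A\<close>. Call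
  \<open>f : A \<rightarrow> B\<close> coherent if \<open>f \<otimes> 1\<close> commutes with these isomorphisms for every \<open>n\<close>. As
  \<open>- \<otimes> \<I>\<close> is faithful, the case \<open>n = 0\<close> shows that there is at most one coherent arrow
  \<open>A \<rightarrow> B\<close>. The pentagon, the triangle and Kelly's identity for \<open>\<lambda>\<close> say that
  \<open>\<alpha>\<close>, \<open>\<rho>\<close> and \<open>\<lambda>\<close> are coherent, and coherent arrows are closed under composition, tensor
  and inverse. These closure properties produce a coherent arrow between any two expressions
  of equal length, and they force every strict monoidal functor to take coherent values.
\<close>

section \<open>Typing rules, isomorphisms and cancellation in a category\<close>

context category
begin

text \<open>Membership in a hom set becomes equations on domain and codomain, so that the simplifier
  can decide composability.\<close>

lemma mem_hom [simp]: "f \<in> hom C A B \<longleftrightarrow> f \<in> Ar C \<and> Dom C f = A \<and> Cod C f = B"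
  by (simp add: hom_def)

lemma Ide_simps [simp]:
  assumes "A \<in> Ob C"
  shows "\<one> A \<in> Ar C" "Dom C (\<one> A) = A" "Cod C (\<one> A) = A"
  using Ide_hom[OF assms] by simp_all

lemma Comp_simps [simp]:
  assumes "f \<in> Ar C" "g \<in> Ar C" "Dom C g = Cod C f"
  shows "g \<cdot> f \<in> Ar C" "Dom C (g \<cdot> f) = Dom C f" "Cod C (g \<cdot> f) = Cod C g"
  using Comp_hom[of f "Dom C f" "Cod C f" g "Cod C g"] assms by simp_all

lemma Comp_Ide_simps [simp]:
  assumes "f \<in> Ar C"
  shows "A = Dom C f \<Longrightarrow> f \<cdot> \<one> A = f" "B = Cod C f \<Longrightarrow> \<one> B \<cdot> f = f"
  using assms Comp_Ide_left Comp_Ide_right by simp_all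

lemma Comp_assoc_right:
  assumes "f \<in> Ar C" "g \<in> Ar C" "h \<in> Ar C" "Dom C g = Cod C f" "Dom C h = Cod C g"
  shows "(h \<cdot> g) \<cdot> f = h \<cdot> (g \<cdot> f)"
  using Comp_assoc[of f _ _ g _ h] assms by simp

lemma is_iso_hom:
  assumes "is_iso C A B f"
  shows "f \<in> Ar C" "Dom C f = A" "Cod C f = B"
  using assms by (simp_all add: is_iso_def)

lemma is_iso_Ide: "A \<in> Ob C \<Longrightarrow> is_iso C A A (\<one> A)"
  by (auto simp: is_iso_def intro!: exI[of _ "\<one> A"])

lemma is_isoI:
  assumes "f \<in> hom C A B" "g \<in> hom C B A" "g \<cdot> f = \<one> A" "f \<cdot> g = \<one> B"
  shows "is_iso C A B f"
  using assms unfolding is_iso_def by blast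

lemma is_isoE:
  assumes "is_iso C A B f"
  obtains g where "g \<in> Ar C" "Dom C g = B" "Cod C g = A" "g \<cdot> f = \<one> A" "f \<cdot> g = \<one> B"
    "is_iso C B A g"
proof -
  obtain g where g: "f \<in> hom C A B" "g \<in> hom C B A" "g \<cdot> f = \<one> A" "f \<cdot> g = \<one> B"
    using assms unfolding is_iso_def by blast
  from that[OF _ _ _ g(3,4) is_isoI[OF g(2,1,4,3)]] g(2) show thesis by simp
qed

lemma is_iso_Comp:
  assumes f: "is_iso C A B f" and g: "is_iso C B D g"
  shows "is_iso C A D (g \<cdot> f)"
proof -
  obtain f' where f': "f' \<in> Ar C" "Dom C f' = B" "Cod C f' = A" "f' \<cdot> f = \<one> A" "f \<cdot> f' = \<one> B"
    using f by (rule is_isoE)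
  obtain g' where g': "g' \<in> Ar C" "Dom C g' = D" "Cod C g' = B" "g' \<cdot> g = \<one> B" "g \<cdot> g' = \<one> D"
    using g by (rule is_isoE)
  note h = is_iso_hom[OF f] is_iso_hom[OF g] f'(1-3) g'(1-3)
  have "g' \<cdot> (g \<cdot> f) = f"
    using Comp_assoc_right[of f g g'] g' h by simp
  moreover have "f \<cdot> (f' \<cdot> g') = g'"
    using Comp_assoc_right[of g' f' f] f' h by simp
  ultimately show ?thesis
    using h f' g' by (intro is_isoI[of _ _ _ "f' \<cdot> g'"]) (simp_all add: Comp_assoc_right)
qed

lemma iso_cancel_right:
  assumes iso: "is_iso C A B f" and eq: "g \<cdot> f = h \<cdot> f"
    and "g \<in> Ar C" "h \<in> Ar C" "Dom C g = B" "Dom C h = B"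
  shows "g = h"
proof -
  obtain f' where "f' \<in> Ar C" "Dom C f' = B" "Cod C f' = A" "f \<cdot> f' = \<one> B"
    using iso by (rule is_isoE)
  then show ?thesis
    using arg_cong[OF eq, of "\<lambda>k. k \<cdot> f'"] assms(3-6) is_iso_hom[OF iso]
    by (simp add: Comp_assoc_right)
qed

lemma iso_cancel_left:
  assumes iso: "is_iso C A B f" and eq: "f \<cdot> g = f \<cdot> h"
    and "g \<in> Ar C" "h \<in> Ar C" "Cod C g = A" "Cod C h = A"
  shows "g = h"
proof -
  obtain f' where f': "f' \<in> Ar C" "Dom C f' = B" "Cod C f' = A" "f' \<cdot> f = \<one> A"
    using iso by (rule is_isoE)
  have "(f' \<cdot> f) \<cdot> g = (f' \<cdot> f) \<cdot> h"
    using eq f'(1-3) assms(3-6) is_iso_hom[OF iso] by (simp add: Comp_assoc_right)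
  then show ?thesis
    using f' assms(3-6) by simp
qed

end

section \<open>Tensoring with the unit, and Kelly's identity for \<lambda>\<lambda>\<close>

context monoidal_category
begin

lemmas Ob_simps [simp] = TensOb_Ob Unit_Ob

lemma TensAr_simps [simp]:
  assumes "f \<in> Ar C" "g \<in> Ar C"
  shows "f \<odot> g \<in> Ar C" "Dom C (f \<odot> g) = Dom C f \<otimes> Dom C g" "Cod C (f \<odot> g) = Cod C f \<otimes> Cod C g"
  using TensAr_hom[of f _ _ g] assms by simp_all

lemma Assoc_simps [simp]:
  assumes "A \<in> Ob C" "B \<in> Ob C" "D \<in> Ob C"
  shows "\<alpha> A B D \<in> Ar C" "Dom C (\<alpha> A B D) = (A \<otimes> B) \<otimes> D" "Cod C (\<alpha> A B D) = A \<otimes> (B \<otimes> D)"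
  using is_iso_hom[OF Assoc_iso[OF assms]] .

lemma Lunit_simps [simp]:
  assumes "A \<in> Ob C"
  shows "\<lambda>\<lambda> A \<in> Ar C" "Dom C (\<lambda>\<lambda> A) = \<I> \<otimes> A" "Cod C (\<lambda>\<lambda> A) = A"
  using is_iso_hom[OF Lunit_iso[OF assms]] .

lemma Runit_simps [simp]:
  assumes "A \<in> Ob C"
  shows "\<rho> A \<in> Ar C" "Dom C (\<rho> A) = A \<otimes> \<I>" "Cod C (\<rho> A) = A"
  using is_iso_hom[OF Runit_iso[OF assms]] .

lemma interchange:
  assumes "f \<in> Ar C" "f' \<in> Ar C" "g \<in> Ar C" "g' \<in> Ar C"
    and "Dom C f' = Cod C f" "Dom C g' = Cod C g"
  shows "(f' \<odot> g') \<cdot> (f \<odot> g) = (f' \<cdot> f) \<odot> (g' \<cdot> g)"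
  using TensAr_Comp[of f _ _ f' _ g _ _ g'] assms by simp

lemma is_iso_TensAr:
  assumes f: "is_iso C A A' f" and g: "is_iso C B B' g"
  shows "is_iso C (A \<otimes> B) (A' \<otimes> B') (f \<odot> g)"
proof -
  note h = is_iso_hom[OF f] is_iso_hom[OF g]
  obtain f' where f': "f' \<in> Ar C" "Dom C f' = A'" "Cod C f' = A" "f' \<cdot> f = \<one> A" "f \<cdot> f' = \<one> A'"
    using f by (rule is_isoE)
  obtain g' where g': "g' \<in> Ar C" "Dom C g' = B'" "Cod C g' = B" "g' \<cdot> g = \<one> B" "g \<cdot> g' = \<one> B'"
    using g by (rule is_isoE)
  have "A \<in> Ob C" "A' \<in> Ob C" "B \<in> Ob C" "B' \<in> Ob C"
    using h Dom_Ob Cod_Ob by auto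
  then show ?thesis
    using h f' g'
    by (intro is_isoI[of _ _ _ "f' \<odot> g'"]) (simp_all add: interchange TensAr_Ide)
qed

text \<open>By naturality of \<rho>, the arrow \<open>f \<odot> \<one> \<I>\<close> determines
  \<open>f \<cdot> \<rho> A\<close>, and \<open>\<rho> A\<close> is invertible.\<close>

lemma tens_Unit_right_faithful:
  assumes "f \<odot> \<one> \<I> = g \<odot> \<one> \<I>" "f \<in> hom C A B" "g \<in> hom C A B"
  shows "f = g"
proof -
  have A: "A \<in> Ob C" using assms Dom_Ob by auto
  have "f \<cdot> \<rho> A = g \<cdot> \<rho> A"
    using Runit_natural[OF assms(2)] Runit_natural[OF assms(3)] assms(1) by metis
  with Runit_iso[OF A] show ?thesis
    by (rule iso_cancel_right) (use assms in simp_all)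
qed

lemma tens_Unit_left_faithful:
  assumes "\<one> \<I> \<odot> f = \<one> \<I> \<odot> g" "f \<in> hom C A B" "g \<in> hom C A B"
  shows "f = g"
proof -
  have A: "A \<in> Ob C" using assms Dom_Ob by auto
  have "f \<cdot> \<lambda>\<lambda> A = g \<cdot> \<lambda>\<lambda> A"
    using Lunit_natural[OF assms(2)] Lunit_natural[OF assms(3)] assms(1) by metis
  with Lunit_iso[OF A] show ?thesis
    by (rule iso_cancel_right) (use assms in simp_all)
qed

text \<open>
  Kelly's redundancy of the second unit axiom: after tensoring with \<open>\<I>\<close> on the left, the
  equation follows from the pentagon for \<open>\<I>, \<I>, A, B\<close> and two triangles.
\<close>

lemma Lunit_TensOb:
  assumes [simp]: "A \<in> Ob C" "B \<in> Ob C"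
  shows "\<lambda>\<lambda> (A \<otimes> B) \<cdot> \<alpha> \<I> A B = \<lambda>\<lambda> A \<odot> \<one> B"
proof (rule tens_Unit_left_faithful)
  \<comment> \<open>These are the two arrows that precede
    \<open>\<one> \<I> \<odot> \<alpha> \<I> A B\<close> in the pentagon. Both are invertible, so it
    suffices to compare the two sides after precomposing with them.\<close>
  let ?a = "\<alpha> \<I> (\<I> \<otimes> A) B" and ?b = "\<alpha> \<I> \<I> A \<odot> \<one> B"
  have l: "\<one> \<I> \<odot> (\<lambda>\<lambda> (A \<otimes> B) \<cdot> \<alpha> \<I> A B) = (\<one> \<I> \<odot> \<lambda>\<lambda> (A \<otimes> B)) \<cdot> (\<one> \<I> \<odot> \<alpha> \<I> A B)"
    by (simp add: interchange)
  have "(\<one> \<I> \<odot> (\<lambda>\<lambda> (A \<otimes> B) \<cdot> \<alpha> \<I> A B)) \<cdot> ?a \<cdot> ?b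
      = (\<one> \<I> \<odot> \<lambda>\<lambda> (A \<otimes> B)) \<cdot> ((\<one> \<I> \<odot> \<alpha> \<I> A B) \<cdot> ?a \<cdot> ?b)"
    unfolding l by (simp add: Comp_assoc_right)
  also have "\<dots> = (\<one> \<I> \<odot> \<lambda>\<lambda> (A \<otimes> B)) \<cdot> \<alpha> \<I> \<I> (A \<otimes> B) \<cdot> \<alpha> (\<I> \<otimes> \<I>) A B"
    by (subst pentagon[symmetric]) (simp_all add: Comp_assoc_right)
  also have "\<dots> = (\<rho> \<I> \<odot> (\<one> A \<odot> \<one> B)) \<cdot> \<alpha> (\<I> \<otimes> \<I>) A B"
    by (simp add: triangle TensAr_Ide)
  also have "\<dots> = \<alpha> \<I> A B \<cdot> ((\<rho> \<I> \<odot> \<one> A) \<odot> \<one> B)"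
    by (rule Assoc_natural[symmetric]) simp_all
  also have "\<dots> = \<alpha> \<I> A B \<cdot> (((\<one> \<I> \<odot> \<lambda>\<lambda> A) \<odot> \<one> B) \<cdot> ?b)"
    by (simp add: triangle[symmetric] interchange)
  also have "\<dots> = (\<alpha> \<I> A B \<cdot> ((\<one> \<I> \<odot> \<lambda>\<lambda> A) \<odot> \<one> B)) \<cdot> ?b"
    by (simp add: Comp_assoc_right)
  also have "\<dots> = (\<one> \<I> \<odot> (\<lambda>\<lambda> A \<odot> \<one> B)) \<cdot> ?a \<cdot> ?b"
    by (subst Assoc_natural) simp_all
  finally have eq: "(\<one> \<I> \<odot> (\<lambda>\<lambda> (A \<otimes> B) \<cdot> \<alpha> \<I> A B)) \<cdot> ?a \<cdot> ?b = (\<one> \<I> \<odot> (\<lambda>\<lambda> A \<odot> \<one> B)) \<cdot> ?a \<cdot> ?b" .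
  have "is_iso C (((\<I> \<otimes> \<I>) \<otimes> A) \<otimes> B) ((\<I> \<otimes> (\<I> \<otimes> A)) \<otimes> B) ?b"
    by (intro is_iso_TensAr Assoc_iso is_iso_Ide) simp_all
  from iso_cancel_right[OF this eq]
  have "(\<one> \<I> \<odot> (\<lambda>\<lambda> (A \<otimes> B) \<cdot> \<alpha> \<I> A B)) \<cdot> ?a = (\<one> \<I> \<odot> (\<lambda>\<lambda> A \<odot> \<one> B)) \<cdot> ?a"
    by simp
  then show "\<one> \<I> \<odot> (\<lambda>\<lambda> (A \<otimes> B) \<cdot> \<alpha> \<I> A B) = \<one> \<I> \<odot> (\<lambda>\<lambda> A \<odot> \<one> B)"
    by (rule iso_cancel_right[OF Assoc_iso, rotated 3]) simp_all
qed simp_all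

end

section \<open>Normal forms and induction in the preorder on one generator\<close>

lemma WCat_simps [simp]:
  "Ob WCat = UNIV" "Ar WCat = {(A, B). wlength A = wlength B}"
  "Dom WCat = fst" "Cod WCat = snd" "Ide WCat = (\<lambda>A. (A, A))"
  "Comp WCat = (\<lambda>g f. (fst f, snd g))" "TensOb WCat = WTens"
  "TensAr WCat = (\<lambda>f g. (WTens (fst f) (fst g), WTens (snd f) (snd g)))" "Unit WCat = WUnit"
  "Assoc WCat = (\<lambda>A B D. (WTens (WTens A B) D, WTens A (WTens B D)))"
  "Lunit WCat = (\<lambda>A. (WTens WUnit A, A))" "Runit WCat = (\<lambda>A. (WTens A WUnit, A))"
  by (simp_all add: WCat_def)

text \<open>The normal form \<open>J n\<close> as an expression. The trailing unit gives an
  arbitrary expression something to be absorbed into.\<close>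

primrec wpow :: "nat \<Rightarrow> wobj" where
  "wpow 0 = WUnit"
| "wpow (Suc n) = WTens WGen (wpow n)"

text \<open>The normal form depends only on the length, so linking each expression to its normal
  form links any two of equal length. The cases match the closure properties of coherent arrows;
  their length hypotheses guarantee that the arrows in question exist in the preorder.\<close>

lemma wobj_same_length_induct [consumes 1, case_names refl sym trans tens assoc lunit runit]:
  assumes len: "wlength A = wlength B"
    and refl: "\<And>A. P A A"
    and sym: "\<And>A B. wlength A = wlength B \<Longrightarrow> P A B \<Longrightarrow> P B A"
    and trans: "\<And>A B D. wlength A = wlength B \<Longrightarrow> wlength B = wlength D \<Longrightarrow> P A B \<Longrightarrow> P B D \<Longrightarrow> P A D"
    and tens: "\<And>A A' B B'. wlength A = wlength A' \<Longrightarrow> wlength B = wlength B' \<Longrightarrow>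
      P A A' \<Longrightarrow> P B B' \<Longrightarrow> P (WTens A B) (WTens A' B')"
    and assoc: "\<And>A B D. P (WTens (WTens A B) D) (WTens A (WTens B D))"
    and lunit: "\<And>A. P (WTens WUnit A) A"
    and runit: "\<And>A. P (WTens A WUnit) A"
  shows "P A B"
proof -
  have [simp]: "wlength (wpow n) = n" for n
    by (induction n) simp_all
  \<comment> \<open>The exponent must vary: once \<open>B\<close> is absorbed into
    \<open>wpow n\<close>, \<open>A\<close> meets \<open>wpow (wlength B + n)\<close>.\<close>
  have absorb: "P (WTens A (wpow n)) (wpow (wlength A + n))" for A n
  proof (induction A arbitrary: n)
    case WUnit
    then show ?case using lunit by simp
  next
    case WGen
    then show ?case using refl by simp
  next
    case (WTens A B)
    have "P (WTens A (WTens B (wpow n))) (WTens A (wpow (wlength B + n)))"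
      using WTens.IH(2) refl by (intro tens) simp_all
    then have "P (WTens A (WTens B (wpow n))) (wpow (wlength A + (wlength B + n)))"
      using WTens.IH(1)[of "wlength B + n"] by (rule trans[rotated 2]) simp_all
    with assoc have "P (WTens (WTens A B) (wpow n)) (wpow (wlength A + (wlength B + n)))"
      by (rule trans[rotated 2]) simp_all
    then show ?case by (simp add: add.assoc)
  qed
  \<comment> \<open>The right unit law, read backwards, supplies the empty normal form
    \<open>wpow 0\<close>.\<close>
  have normal: "P A (wpow (wlength A))" for A
  proof (rule trans)
    show "P A (WTens A WUnit)" by (rule sym[OF _ runit]) simp
    show "P (WTens A WUnit) (wpow (wlength A))" using absorb[of A 0] by simp
  qed simp_all
  show ?thesis
  proof (rule trans)
    show "P A (wpow (wlength A))" by (rule normal)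
    show "P (wpow (wlength A)) B" using sym[OF _ normal[of B]] len by simp
  qed (use len in simp_all)
qed

section \<open>Evaluation of expressions and their action on normal forms\<close>

locale pointed_monoidal_category = monoidal_category C
  for C :: "('o, 'm, 'x) moncat_scheme" (structure) +
  fixes M :: 'o
  assumes M_Ob [simp]: "M \<in> Ob C"
begin

primrec eval_ob :: "wobj \<Rightarrow> 'o" where
  "eval_ob WUnit = \<I>"
| "eval_ob WGen = M"
| "eval_ob (WTens A B) = eval_ob A \<otimes> eval_ob B"

abbreviation "pow n \<equiv> eval_ob (wpow n)"

lemma eval_ob_Ob [simp]: "eval_ob A \<in> Ob C"
  by (induction A) simp_all

text \<open>A generator acts by an identity because \<open>M \<otimes> pow n\<close> is
  \<open>pow (Suc n)\<close> by definition. In a product the right factor acts first, which shifts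
  the exponent at which the left one acts.\<close>

primrec absorb :: "wobj \<Rightarrow> nat \<Rightarrow> 'm" where
  "absorb WUnit n = \<lambda>\<lambda> (pow n)"
| "absorb WGen n = \<one> (M \<otimes> pow n)"
| "absorb (WTens A B) n =
    absorb A (wlength B + n) \<cdot> ((\<one> (eval_ob A) \<odot> absorb B n) \<cdot> \<alpha> (eval_ob A) (eval_ob B) (pow n))"

lemma absorb_iso: "is_iso C (eval_ob A \<otimes> pow n) (pow (wlength A + n)) (absorb A n)"
proof (induction A arbitrary: n)
  case (WTens A B)
  have "is_iso C ((eval_ob A \<otimes> eval_ob B) \<otimes> pow n) (pow (wlength A + (wlength B + n)))
    (absorb (WTens A B) n)"
    unfolding absorb.simps
    by (rule is_iso_Comp[OF is_iso_Comp[OF Assoc_iso is_iso_TensAr[OF is_iso_Ide WTens.IH(2)]]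
          WTens.IH(1)]) simp_all
  then show ?case by (simp add: add.assoc)
qed (simp_all add: Lunit_iso is_iso_Ide)

lemmas absorb_simps [simp] = is_iso_hom[OF absorb_iso]

section \<open>Coherent arrows: uniqueness, closure properties and existence\<close>

definition coherent :: "wobj \<Rightarrow> wobj \<Rightarrow> 'm \<Rightarrow> bool" where
  "coherent A B f \<longleftrightarrow> f \<in> hom C (eval_ob A) (eval_ob B) \<and> wlength A = wlength B \<and>
     (\<forall>n. absorb B n \<cdot> (f \<odot> \<one> (pow n)) = absorb A n)"

lemma coherentD:
  assumes "coherent A B f"
  shows "f \<in> Ar C" "Dom C f = eval_ob A" "Cod C f = eval_ob B" "wlength A = wlength B"
    "absorb B n \<cdot> (f \<odot> \<one> (pow n)) = absorb A n"
  using assms by (simp_all add: coherent_def)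

lemma coherent_unique:
  assumes f: "coherent A B f" and g: "coherent A B g"
  shows "f = g"
proof (rule tens_Unit_right_faithful)
  have "absorb B 0 \<cdot> (f \<odot> \<one> \<I>) = absorb B 0 \<cdot> (g \<odot> \<one> \<I>)"
    using coherentD(5)[OF f, of 0] coherentD(5)[OF g, of 0] by simp
  with absorb_iso[of B 0] show "f \<odot> \<one> \<I> = g \<odot> \<one> \<I>"
    by (rule iso_cancel_left) (simp_all add: coherentD(1-3)[OF f] coherentD(1-3)[OF g])
qed (use f g in \<open>simp_all add: coherent_def\<close>)

lemma coherent_Ide: "coherent A A (\<one> (eval_ob A))"
  by (simp add: coherent_def TensAr_Ide)

lemma coherent_Comp:
  assumes f: "coherent A B f" and g: "coherent B D g"
  shows "coherent A D (g \<cdot> f)"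
proof -
  note [simp] = coherentD(1-3)[OF f] coherentD(1-3)[OF g]
  note len = coherentD(4)[OF f] coherentD(4)[OF g]
  have "absorb D n \<cdot> ((g \<cdot> f) \<odot> \<one> (pow n)) = absorb A n" for n
  proof -
    have "absorb D n \<cdot> ((g \<cdot> f) \<odot> \<one> (pow n))
        = absorb D n \<cdot> ((g \<odot> \<one> (pow n)) \<cdot> (f \<odot> \<one> (pow n)))"
      by (simp add: interchange)
    also have "\<dots> = (absorb D n \<cdot> (g \<odot> \<one> (pow n))) \<cdot> (f \<odot> \<one> (pow n))"
      by (simp add: Comp_assoc_right)
    finally show ?thesis
      by (simp add: coherentD(5)[OF f] coherentD(5)[OF g])
  qed
  with len show ?thesis by (simp add: coherent_def)
qed

text \<open>Coherence of \<open>f\<close> replaces \<open>absorb A n\<close> by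
  \<open>absorb B n \<cdot> (f \<odot> \<one> (pow n))\<close>; then \<open>f\<close> meets
  \<open>g\<close> and the two cancel.\<close>

lemma coherent_inverse:
  assumes f: "coherent A B f" and g: "g \<in> hom C (eval_ob B) (eval_ob A)"
    and inv: "f \<cdot> g = \<one> (eval_ob B)"
  shows "coherent B A g"
proof -
  note [simp] = coherentD(1-3)[OF f]
  have [simp]: "g \<in> Ar C" "Dom C g = eval_ob B" "Cod C g = eval_ob A"
    using g by simp_all
  have "absorb A n \<cdot> (g \<odot> \<one> (pow n)) = absorb B n" for n
  proof -
    have "absorb A n \<cdot> (g \<odot> \<one> (pow n))
        = (absorb B n \<cdot> (f \<odot> \<one> (pow n))) \<cdot> (g \<odot> \<one> (pow n))"
      by (simp add: coherentD(5)[OF f])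
    also have "\<dots> = absorb B n \<cdot> ((f \<odot> \<one> (pow n)) \<cdot> (g \<odot> \<one> (pow n)))"
      by (subst Comp_assoc_right) simp_all
    finally show ?thesis
      by (simp add: interchange inv TensAr_Ide)
  qed
  with coherentD(4)[OF f] show ?thesis by (simp add: coherent_def)
qed

text \<open>Naturality of \<alpha> turns \<open>(f \<odot> g) \<odot> \<one>\<close> into
  \<open>f \<odot> (g \<odot> \<one>)\<close>. Then \<open>g\<close> is absorbed at \<open>n\<close>
  and \<open>f\<close> at \<open>wlength B + n\<close>; this shift is why coherence is demanded for
  all exponents at once.\<close>

lemma coherent_TensAr:
  assumes f: "coherent A A' f" and g: "coherent B B' g"
  shows "coherent (WTens A B) (WTens A' B') (f \<odot> g)"
proof -
  note [simp] = coherentD(1-3)[OF f] coherentD(1-3)[OF g]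
  note len = coherentD(4)[OF f] coherentD(4)[OF g]
  have "absorb (WTens A' B') n \<cdot> ((f \<odot> g) \<odot> \<one> (pow n)) = absorb (WTens A B) n" for n
  proof -
    let ?J = "pow n" and ?m = "wlength B + n"
    let ?\<alpha> = "\<alpha> (eval_ob A) (eval_ob B) ?J" and ?\<alpha>' = "\<alpha> (eval_ob A') (eval_ob B') ?J"
    have "absorb (WTens A' B') n \<cdot> ((f \<odot> g) \<odot> \<one> ?J)
        = absorb A' ?m \<cdot> ((\<one> (eval_ob A') \<odot> absorb B' n) \<cdot> (?\<alpha>' \<cdot> ((f \<odot> g) \<odot> \<one> ?J)))"
      by (simp add: Comp_assoc_right len)
    also have "?\<alpha>' \<cdot> ((f \<odot> g) \<odot> \<one> ?J) = (f \<odot> (g \<odot> \<one> ?J)) \<cdot> ?\<alpha>"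
      by (rule Assoc_natural) simp_all
    also have "(\<one> (eval_ob A') \<odot> absorb B' n) \<cdot> ((f \<odot> (g \<odot> \<one> ?J)) \<cdot> ?\<alpha>)
        = ((\<one> (eval_ob A') \<odot> absorb B' n) \<cdot> (f \<odot> (g \<odot> \<one> ?J))) \<cdot> ?\<alpha>"
      by (simp add: Comp_assoc_right)
    also have "(\<one> (eval_ob A') \<odot> absorb B' n) \<cdot> (f \<odot> (g \<odot> \<one> ?J)) = f \<odot> absorb B n"
      by (simp add: interchange coherentD(5)[OF g])
    \<comment> \<open>Of the two ways to split the product, this one puts \<open>f\<close> next to
      \<open>absorb A' ?m\<close>.\<close>
    also have "\<dots> = (f \<odot> \<one> (pow ?m)) \<cdot> (\<one> (eval_ob A) \<odot> absorb B n)"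
      by (simp add: interchange)
    also have "absorb A' ?m \<cdot> ((f \<odot> \<one> (pow ?m)) \<cdot> (\<one> (eval_ob A) \<odot> absorb B n) \<cdot> ?\<alpha>)
        = (absorb A' ?m \<cdot> (f \<odot> \<one> (pow ?m))) \<cdot> ((\<one> (eval_ob A) \<odot> absorb B n) \<cdot> ?\<alpha>)"
      by (simp add: Comp_assoc_right len)
    finally show ?thesis
      by (simp add: coherentD(5)[OF f])
  qed
  with len show ?thesis by (simp add: coherent_def)
qed

text \<open>The two sides contain the two paths of the pentagon for \<open>A\<close>,
  \<open>B\<close>, \<open>D\<close> and \<open>pow n\<close>; naturality of \<alpha> moves the
  action of \<open>D\<close> into place.\<close>

lemma coherent_Assoc:
  "coherent (WTens (WTens A B) D) (WTens A (WTens B D)) (\<alpha> (eval_ob A) (eval_ob B) (eval_ob D))"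
proof -
  have "absorb (WTens A (WTens B D)) n \<cdot> (\<alpha> (eval_ob A) (eval_ob B) (eval_ob D) \<odot> \<one> (pow n))
      = absorb (WTens (WTens A B) D) n" for n
  proof -
    let ?A = "eval_ob A" and ?B = "eval_ob B" and ?D = "eval_ob D" and ?J = "pow n"
    let ?k = "wlength D + n"
    let ?a = "absorb A (wlength B + ?k)" and ?b = "absorb B ?k" and ?d = "absorb D n"
    have "absorb (WTens A (WTens B D)) n \<cdot> (\<alpha> ?A ?B ?D \<odot> \<one> ?J)
        = ?a \<cdot> ((\<one> ?A \<odot> (?b \<cdot> ((\<one> ?B \<odot> ?d) \<cdot> \<alpha> ?B ?D ?J)))
            \<cdot> (\<alpha> ?A (?B \<otimes> ?D) ?J \<cdot> (\<alpha> ?A ?B ?D \<odot> \<one> ?J)))"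
      by (simp add: Comp_assoc_right add.assoc)
    also have "\<one> ?A \<odot> (?b \<cdot> ((\<one> ?B \<odot> ?d) \<cdot> \<alpha> ?B ?D ?J))
        = (\<one> ?A \<odot> ?b) \<cdot> ((\<one> ?A \<odot> (\<one> ?B \<odot> ?d)) \<cdot> (\<one> ?A \<odot> \<alpha> ?B ?D ?J))"
      by (simp add: interchange)
    also have "\<dots> \<cdot> (\<alpha> ?A (?B \<otimes> ?D) ?J \<cdot> (\<alpha> ?A ?B ?D \<odot> \<one> ?J))
        = (\<one> ?A \<odot> ?b) \<cdot> ((\<one> ?A \<odot> (\<one> ?B \<odot> ?d))
          \<cdot> ((\<one> ?A \<odot> \<alpha> ?B ?D ?J) \<cdot> \<alpha> ?A (?B \<otimes> ?D) ?J \<cdot> (\<alpha> ?A ?B ?D \<odot> \<one> ?J)))"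
      by (simp add: Comp_assoc_right)
    also have "(\<one> ?A \<odot> \<alpha> ?B ?D ?J) \<cdot> \<alpha> ?A (?B \<otimes> ?D) ?J \<cdot> (\<alpha> ?A ?B ?D \<odot> \<one> ?J)
        = \<alpha> ?A ?B (?D \<otimes> ?J) \<cdot> \<alpha> (?A \<otimes> ?B) ?D ?J"
      by (rule pentagon[symmetric]) simp_all
    also have "(\<one> ?A \<odot> (\<one> ?B \<odot> ?d)) \<cdot> (\<alpha> ?A ?B (?D \<otimes> ?J) \<cdot> \<alpha> (?A \<otimes> ?B) ?D ?J)
        = ((\<one> ?A \<odot> (\<one> ?B \<odot> ?d)) \<cdot> \<alpha> ?A ?B (?D \<otimes> ?J)) \<cdot> \<alpha> (?A \<otimes> ?B) ?D ?J"
      by (simp add: Comp_assoc_right)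
    \<comment> \<open>Naturality in the last variable only; the two identities then merge into that
      of \<open>?A \<otimes> ?B\<close>.\<close>
    also have "(\<one> ?A \<odot> (\<one> ?B \<odot> ?d)) \<cdot> \<alpha> ?A ?B (?D \<otimes> ?J)
        = \<alpha> ?A ?B (pow ?k) \<cdot> ((\<one> ?A \<odot> \<one> ?B) \<odot> ?d)"
      by (rule Assoc_natural[symmetric]) simp_all
    finally show ?thesis
      by (simp add: Comp_assoc_right TensAr_Ide)
  qed
  then show ?thesis by (simp add: coherent_def del: absorb.simps)
qed

text \<open>Kelly's identity rewrites
  \<open>\<lambda>\<lambda> (eval_ob A) \<odot> \<one> (pow n)\<close> through the unitor at
  \<open>eval_ob A \<otimes> pow n\<close>, which naturality moves past
  \<open>absorb A n\<close>.\<close>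

lemma coherent_Lunit: "coherent (WTens WUnit A) A (\<lambda>\<lambda> (eval_ob A))"
proof -
  have "absorb A n \<cdot> (\<lambda>\<lambda> (eval_ob A) \<odot> \<one> (pow n)) = absorb (WTens WUnit A) n" for n
  proof -
    have "absorb A n \<cdot> (\<lambda>\<lambda> (eval_ob A) \<odot> \<one> (pow n))
        = (absorb A n \<cdot> \<lambda>\<lambda> (eval_ob A \<otimes> pow n)) \<cdot> \<alpha> \<I> (eval_ob A) (pow n)"
      by (simp add: Lunit_TensOb[symmetric] Comp_assoc_right)
    also have "absorb A n \<cdot> \<lambda>\<lambda> (eval_ob A \<otimes> pow n)
        = \<lambda>\<lambda> (pow (wlength A + n)) \<cdot> (\<one> \<I> \<odot> absorb A n)"
      by (rule Lunit_natural[symmetric]) simp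
    finally show ?thesis
      by (simp add: Comp_assoc_right)
  qed
  then show ?thesis by (simp add: coherent_def del: absorb.simps)
qed

text \<open>The unit acts by \<open>\<lambda>\<lambda> (pow n)\<close>, so
  \<open>absorb (WTens A WUnit) n\<close> is \<open>absorb A n\<close> after the left side of the
  triangle.\<close>

lemma coherent_Runit: "coherent (WTens A WUnit) A (\<rho> (eval_ob A))"
  by (simp add: coherent_def triangle)

text \<open>Invertibility is carried through the induction because the symmetric case takes an
  inverse.\<close>

lemma coherent_iso_exists:
  assumes "wlength A = wlength B"
  shows "\<exists>f. coherent A B f \<and> is_iso C (eval_ob A) (eval_ob B) f"
  using assms
proof (induction rule: wobj_same_length_induct)
  case (refl A)
  show ?case using coherent_Ide is_iso_Ide eval_ob_Ob by blast
next
  case (sym A B)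
  then obtain f where f: "coherent A B f" "is_iso C (eval_ob A) (eval_ob B) f" by blast
  from f(2) show ?case
    by (rule is_isoE) (use coherent_inverse[OF f(1)] in auto)
next
  case (trans A B D)
  then show ?case using coherent_Comp is_iso_Comp by blast
next
  case (tens A A' B B')
  then show ?case using coherent_TensAr is_iso_TensAr by fastforce
next
  case (assoc A B D)
  show ?case using coherent_Assoc Assoc_iso by fastforce
next
  case (lunit A)
  show ?case using coherent_Lunit Lunit_iso by fastforce
next
  case (runit A)
  show ?case using coherent_Runit Runit_iso by fastforce
qed

section \<open>The strict monoidal functor and its uniqueness\<close>

definition eval_ar :: "wobj \<times> wobj \<Rightarrow> 'm" where
  "eval_ar = (\<lambda>(A, B) \<in> Ar WCat. THE f. coherent A B f)"

lemma eval_ar_eq: "coherent A B f \<Longrightarrow> eval_ar (A, B) = f"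
  using coherent_unique coherentD(4)
  by (auto simp: eval_ar_def intro!: the_equality)

lemma coherent_eval_ar:
  assumes "wlength A = wlength B"
  shows "coherent A B (eval_ar (A, B))"
  using coherent_iso_exists[OF assms] eval_ar_eq by blast

text \<open>The arrow map is restricted to \<open>Ar WCat\<close> to be extensional; the components
  on objects are so automatically, as \<open>Ob WCat\<close> is \<open>UNIV\<close>.\<close>

definition eval_functor :: "(wobj, wobj \<times> wobj, 'o, 'm) moncat_functor" where
  "eval_functor = \<lparr>ObMap = eval_ob, ArMap = eval_ar,
     Tensorator = (\<lambda>(A, B). \<one> (eval_ob A \<otimes> eval_ob B)), Unitor = \<one> \<I>\<rparr>"

text \<open>Each right-hand side is coherent, hence equal to the one coherent arrow of its type.
  Composites and tensors are treated in the same way below.\<close>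

lemma eval_ar_structure:
  "eval_ar (A, A) = \<one> (eval_ob A)"
  "eval_ar (WTens (WTens A B) D, WTens A (WTens B D)) = \<alpha> (eval_ob A) (eval_ob B) (eval_ob D)"
  "eval_ar (WTens WUnit A, A) = \<lambda>\<lambda> (eval_ob A)"
  "eval_ar (WTens A WUnit, A) = \<rho> (eval_ob A)"
  using coherent_Ide coherent_Assoc coherent_Lunit coherent_Runit by (simp_all add: eval_ar_eq)

lemma eval_ar_Comp:
  assumes "wlength A = wlength B" "wlength B = wlength D"
  shows "eval_ar (B, D) \<cdot> eval_ar (A, B) = eval_ar (A, D)"
  using coherent_Comp[OF coherent_eval_ar[OF assms(1)] coherent_eval_ar[OF assms(2)]]
  by (simp add: eval_ar_eq)

lemma eval_ar_TensAr:
  assumes "wlength A = wlength A'" "wlength B = wlength B'"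
  shows "eval_ar (WTens A B, WTens A' B') = eval_ar (A, A') \<odot> eval_ar (B, B')"
  using coherent_TensAr[OF coherent_eval_ar[OF assms(1)] coherent_eval_ar[OF assms(2)]]
  by (simp add: eval_ar_eq)

lemma strict_monoidal_eval_functor: "strict_monoidal_functor WCat C eval_functor"
proof -
  interpret W: monoidal_category WCat by (rule monoidal_category_WCat)
  have [simp]: "ObMap eval_functor = eval_ob" "ArMap eval_functor = eval_ar"
    "Tensorator eval_functor = (\<lambda>(A, B). \<one> (eval_ob A \<otimes> eval_ob B))"
    "Unitor eval_functor = \<one> \<I>"
    by (simp_all add: eval_functor_def)
  note [simp] = coherentD(1-3)[OF coherent_eval_ar]
  have "eval_ar \<in> Ar WCat \<rightarrow>\<^sub>E Ar C"
    \<comment> \<open>Typing needs \<open>eval_ar\<close> folded; only the value off the arrows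
      needs its definition.\<close>
    by (rule PiE_I) (auto, auto simp: eval_ar_def)
  then show ?thesis
    \<comment> \<open>Arrows of the preorder become explicit pairs through \<open>hom_WCat\<close>,
      in whose favour \<open>W.mem_hom\<close> is switched off.\<close>
    by unfold_locales
      (auto simp: hom_WCat eval_ar_structure eval_ar_Comp eval_ar_TensAr TensAr_Ide
        simp del: W.mem_hom split: if_splits)
qed

text \<open>Strictness fixes the object map by recursion and sends structure maps to structure maps.
  Induction along equal lengths then makes every value on arrows coherent, and coherent arrows are
  unique.\<close>

lemma strict_functor_unique:
  fixes F :: "(wobj, wobj \<times> wobj, 'o, 'm) moncat_functor"
  assumes strict: "strict_monoidal_functor WCat C F" and gen: "ObMap F WGen = M"
  shows "F = eval_functor"
proof -
  interpret F: strict_monoidal_functor WCat C F by (rule strict)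
  have ob: "ObMap F A = eval_ob A" for A
  proof (induction A)
    case WUnit
    show ?case using F.strict_ObMap_Unit by simp
  next
    case WGen
    show ?case using gen by simp
  next
    case (WTens A B)
    then show ?case using F.strict_ObMap_TensOb[of A B] by simp
  qed
  have F_hom: "ArMap F (A, B) \<in> hom C (eval_ob A) (eval_ob B)" if "wlength A = wlength B" for A B
    using F.ArMap_hom[of "(A, B)" A B] that ob by simp
  have F_Ide: "ArMap F (A, A) = \<one> (eval_ob A)" for A
    using F.ArMap_Ide[of A] ob by simp
  have F_Comp: "ArMap F (A, D) = ArMap F (B, D) \<cdot> ArMap F (A, B)"
    if "wlength A = wlength B" "wlength B = wlength D" for A B D
    using F.ArMap_Comp[of "(A, B)" A B "(B, D)" D] that by simp
  have "coherent A B (ArMap F (A, B))" if "wlength A = wlength B" for A B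
    using that
  proof (induction rule: wobj_same_length_induct)
    case (refl A)
    show ?case using coherent_Ide by (simp add: F_Ide)
  next
    case (sym A B)
    \<comment> \<open>The images of \<open>(A, B)\<close> and \<open>(B, A)\<close> are mutually
      inverse, since their composites in the preorder are identities.\<close>
    then show ?case
      using F_hom[of B A] F_Comp[of B A B] by (intro coherent_inverse[of A B]) (simp_all add: F_Ide)
  next
    case (trans A B D)
    then show ?case using coherent_Comp F_Comp by metis
  next
    case (tens A A' B B')
    then have "ArMap F (WTens A B, WTens A' B') = ArMap F (A, A') \<odot> ArMap F (B, B')"
      using F.strict_ArMap_TensAr[of "(A, A')" A A' "(B, B')" B B'] by simp
    with tens show ?case using coherent_TensAr by simp
  next
    case (assoc A B D)
    show ?case using coherent_Assoc F.strict_ArMap_Assoc[of A B D] ob by simp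
  next
    case (lunit A)
    show ?case using coherent_Lunit F.strict_ArMap_Lunit[of A] ob by simp
  next
    case (runit A)
    show ?case using coherent_Runit F.strict_ArMap_Runit[of A] ob by simp
  qed
  then have "eval_ar (A, B) = ArMap F (A, B)" if "(A, B) \<in> Ar WCat" for A B
    using that by (intro eval_ar_eq) simp
  \<comment> \<open>Both maps are \<open>undefined\<close> off the arrows, so agreement on arrows is
    equality.\<close>
  then have ar: "ArMap F = eval_ar"
    by (intro extensionalityI[of _ "Ar WCat"])
      (use F.ArMap_funcset in \<open>auto simp: eval_ar_def PiE_def\<close>)
  have tens: "Tensorator F = (\<lambda>(A, B). \<one> (eval_ob A \<otimes> eval_ob B))"
    using F.Tensorator_Ide ob by auto
  show ?thesis
    using ob ar tens F.Unitor_Ide by (auto simp: eval_functor_def intro!: moncat_functor.equality)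
qed

end

theorem theorem5p1:
  fixes \<M> :: "('o, 'm) moncat" and M :: 'o
  assumes "monoidal_category \<M>" and "M \<in> Ob \<M>"
  shows "\<exists>!F :: (wobj, wobj \<times> wobj, 'o, 'm) moncat_functor.
    strict_monoidal_functor WCat \<M> F \<and> ObMap F WGen = M"
proof -
  interpret pointed_monoidal_category \<M> M
    using assms by (simp add: pointed_monoidal_category_def pointed_monoidal_category_axioms_def)
  show ?thesis
  proof (rule ex1I)
    show "strict_monoidal_functor WCat \<M> eval_functor \<and> ObMap eval_functor WGen = M"
      using strict_monoidal_eval_functor by (simp add: eval_functor_def)
  qed (use strict_functor_unique in blast)
qed

end
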